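(* Let $\mathcal{G}$ be a groupoid and $g\in\mathcal{G}$. Then: (i) $d(g)=r(g^{-1})$; (ii) $d(d(g))=d(g)$; (iii) $r(r(g))=r(g)$; (iv) $d(r(g))=r(g)$; (v) $r(d(g))=d(g)$.
   Context: A groupoid is a set $\mathcal{G}$ with a partial binary operation, written by concatenation ($\exists gh$ means that $gh$ is defined). An element $e$ is an identity if $\exists eg$ implies $eg=g$ and $\exists g'e$ implies $g'e=g'$. Axioms: (i) $\exists g(hl)$ iff $\exists (gh)l$, and then $g(hl)=(gh)l$; (ii) $\exists g(hl)$ iff $\exists gh$ and $\exists hl$; (iii) for each $g$ there are unique identities $d(g),r(g)$ with $\exists gd(g)$ and $\exists r(g)g$; (iv) for each $g$ there is a (necessarily unique) element $g^{-1}$ with $\exists g^{-1}g$, $\exists gg^{-1}$, $d(g)=g^{-1}g$, $r(g)=gg^{-1}$. *)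

theory Defs
  imports Main
begin

text \<open>
  A partial binary operation on the set \<open>G\<close> is a function \<open>m\<close> with values in an option type:
  \<open>m g h = None\<close> means that the product \<open>gh\<close> is undefined. Only the values of \<open>m\<close> at arguments
  in \<open>G\<close> are relevant.
\<close>

type_synonym 'a partial_op = "'a \<Rightarrow> 'a \<Rightarrow> 'a option"

definition defined :: "'a option \<Rightarrow> bool" where
  "defined x \<longleftrightarrow> x \<noteq> None"

text \<open>
  The iterated products \<open>g(hl)\<close> and \<open>(gh)l\<close>; each is undefined as soon as its inner product is.
\<close>

definition rprod :: "'a partial_op \<Rightarrow> 'a \<Rightarrow> 'a \<Rightarrow> 'a \<Rightarrow> 'a option" where
  "rprod m g h l = Option.bind (m h l) (\<lambda>x. m g x)"

definition lprod :: "'a partial_op \<Rightarrow> 'a \<Rightarrow> 'a \<Rightarrow> 'a \<Rightarrow> 'a option" where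
  "lprod m g h l = Option.bind (m g h) (\<lambda>x. m x l)"

definition is_identity :: "'a set \<Rightarrow> 'a partial_op \<Rightarrow> 'a \<Rightarrow> bool" where
  "is_identity G m e \<longleftrightarrow> e \<in> G \<and>
     (\<forall>g\<in>G. defined (m e g) \<longrightarrow> m e g = Some g) \<and>
     (\<forall>g'\<in>G. defined (m g' e) \<longrightarrow> m g' e = Some g')"

definition dom_id :: "'a set \<Rightarrow> 'a partial_op \<Rightarrow> 'a \<Rightarrow> 'a" where
  "dom_id G m g = (THE e. is_identity G m e \<and> defined (m g e))"

definition ran_id :: "'a set \<Rightarrow> 'a partial_op \<Rightarrow> 'a \<Rightarrow> 'a" where
  "ran_id G m g = (THE e. is_identity G m e \<and> defined (m e g))"

definition is_inverse :: "'a set \<Rightarrow> 'a partial_op \<Rightarrow> 'a \<Rightarrow> 'a \<Rightarrow> bool" where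
  "is_inverse G m g h \<longleftrightarrow> h \<in> G \<and> m h g = Some (dom_id G m g) \<and> m g h = Some (ran_id G m g)"

definition inverse_of :: "'a set \<Rightarrow> 'a partial_op \<Rightarrow> 'a \<Rightarrow> 'a" where
  "inverse_of G m g = (THE h. is_inverse G m g h)"

text \<open>
  Uniqueness of inverses, on which the description operator in \<open>inverse_of\<close> relies, is a
  consequence of the axioms and is not assumed.
\<close>

locale groupoid =
  fixes G :: "'a set" and m :: "'a partial_op"
  assumes closed: "\<lbrakk>g \<in> G; h \<in> G; m g h = Some k\<rbrakk> \<Longrightarrow> k \<in> G"
    and assoc_defined: "\<lbrakk>g \<in> G; h \<in> G; l \<in> G\<rbrakk> \<Longrightarrow>
      defined (rprod m g h l) \<longleftrightarrow> defined (lprod m g h l)"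
    and assoc: "\<lbrakk>g \<in> G; h \<in> G; l \<in> G; defined (rprod m g h l)\<rbrakk> \<Longrightarrow>
      rprod m g h l = lprod m g h l"
    and rprod_defined: "\<lbrakk>g \<in> G; h \<in> G; l \<in> G\<rbrakk> \<Longrightarrow>
      defined (rprod m g h l) \<longleftrightarrow> defined (m g h) \<and> defined (m h l)"
    and ex1_dom: "g \<in> G \<Longrightarrow> \<exists>!e. is_identity G m e \<and> defined (m g e)"
    and ex1_ran: "g \<in> G \<Longrightarrow> \<exists>!e. is_identity G m e \<and> defined (m e g)"
    and ex_inverse: "g \<in> G \<Longrightarrow> \<exists>h. is_inverse G m g h"

end

theory Submission imports Defs
begin

text \<open>
  Two facts carry the proof. First, if \<open>e\<close> is an identity then the defined product of \<open>e\<close> with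
  its domain identity equals both factors, so \<open>e\<close> is its own domain identity, and likewise its
  own range identity; as \<open>d(g)\<close> and \<open>r(g)\<close> are identities, this gives the four equations without
  inverses. Second, if \<open>h\<close>
  is an inverse of \<open>g\<close>, then \<open>hg\<close> and \<open>gh\<close> are defined, hence so is \<open>(hg)h = d(g)h\<close>, which says
  that \<open>d(g)\<close> is the range identity of \<open>h\<close>. The remaining point is that inverses are unique, so
  that this applies to \<open>g\<^sup>-\<^sup>1\<close>.
\<close>

context groupoid
begin

lemma dom_id_props:
  assumes "g \<in> G"
  shows "is_identity G m (dom_id G m g)" and "defined (m g (dom_id G m g))"
  using theI'[OF ex1_dom[OF assms]] unfolding dom_id_def by auto

lemma ran_id_props:
  assumes "g \<in> G"
  shows "is_identity G m (ran_id G m g)" and "defined (m (ran_id G m g) g)"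
  using theI'[OF ex1_ran[OF assms]] unfolding ran_id_def by auto

lemma ran_id_eqI:
  assumes "g \<in> G" "is_identity G m e" "defined (m e g)"
  shows "ran_id G m g = e"
  using ex1_ran[OF assms(1)] ran_id_props[OF assms(1)] assms(2,3) by blast

text \<open>When two identities are composable, their product is each of them, so they coincide.\<close>

lemma composable_identities_eq:
  assumes "is_identity G m e" "is_identity G m f" "defined (m e f)"
  shows "e = f"
proof -
  have "m e f = Some f" "m e f = Some e"
    using assms unfolding is_identity_def by blast+
  then show ?thesis by simp
qed

lemma dom_id_identity:
  assumes "is_identity G m e"
  shows "dom_id G m e = e"
proof -
  have "e \<in> G" using assms by (simp add: is_identity_def)
  then show ?thesis
    using composable_identities_eq[OF assms dom_id_props] by simp
qed

lemma ran_id_identity: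
  assumes "is_identity G m e"
  shows "ran_id G m e = e"
proof -
  have "e \<in> G" using assms by (simp add: is_identity_def)
  then show ?thesis
    using composable_identities_eq[OF ran_id_props(1) assms ran_id_props(2)] by simp
qed

text \<open>
  A triple product is defined as soon as its two adjacent products are, and then the bracketing
  does not matter; stated with named values, so that the option-valued bindings disappear.
\<close>

lemma composable_assoc:
  assumes "g \<in> G" "h \<in> G" "l \<in> G" and gh: "m g h = Some x" and hl: "m h l = Some y"
  shows "m g y = m x l" and "defined (m x l)"
proof -
  have "defined (rprod m g h l)"
    using rprod_defined[OF assms(1-3)] gh hl by (simp add: defined_def)
  then show "m g y = m x l" "defined (m x l)"
    using assoc[OF assms(1-3)] gh hl by (simp_all add: rprod_def lprod_def)
qed

text \<open>For inverses \<open>h\<close> and \<open>k\<close> of \<open>g\<close>, the product \<open>hgk\<close> is \<open>d(g)k = k\<close> and \<open>h r(g) = h\<close>.\<close>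

lemma inverse_unique:
  assumes "g \<in> G" and h: "is_inverse G m g h" and k: "is_inverse G m g k"
  shows "h = k"
proof -
  let ?d = "dom_id G m g" and ?r = "ran_id G m g"
  have "h \<in> G" "k \<in> G" and hg: "m h g = Some ?d" and gk: "m g k = Some ?r"
    using h k by (auto simp: is_inverse_def)
  note hgk = composable_assoc[OF \<open>h \<in> G\<close> \<open>g \<in> G\<close> \<open>k \<in> G\<close> hg gk]
  have "m ?d k = Some k"
    using dom_id_props(1)[OF \<open>g \<in> G\<close>] hgk(2) \<open>k \<in> G\<close> by (simp add: is_identity_def)
  moreover have "m h ?r = Some h"
    using ran_id_props(1)[OF \<open>g \<in> G\<close>] hgk \<open>h \<in> G\<close> by (simp add: is_identity_def)
  ultimately show ?thesis using hgk(1) by simp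
qed

lemma is_inverse_inverse_of:
  assumes "g \<in> G"
  shows "is_inverse G m g (inverse_of G m g)"
proof -
  have "\<exists>!h. is_inverse G m g h"
    using ex_inverse[OF assms] inverse_unique[OF assms] by blast
  then show ?thesis unfolding inverse_of_def by (rule theI')
qed

lemma ran_id_inverse:
  assumes "g \<in> G" and h: "is_inverse G m g h"
  shows "ran_id G m h = dom_id G m g"
proof (rule ran_id_eqI)
  show "h \<in> G" using h by (simp add: is_inverse_def)
  then show "defined (m (dom_id G m g) h)"
    using composable_assoc(2)[OF _ \<open>g \<in> G\<close>] h by (simp add: is_inverse_def)
  show "is_identity G m (dom_id G m g)" by (rule dom_id_props(1)[OF \<open>g \<in> G\<close>])
qed

end

theorem proposition2p8:
  fixes G :: "'a set" and m :: "'a partial_op" and g :: 'a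
  assumes "groupoid G m" and "g \<in> G"
  shows "dom_id G m g = ran_id G m (inverse_of G m g)
    \<and> dom_id G m (dom_id G m g) = dom_id G m g
    \<and> ran_id G m (ran_id G m g) = ran_id G m g
    \<and> dom_id G m (ran_id G m g) = ran_id G m g
    \<and> ran_id G m (dom_id G m g) = dom_id G m g"
proof -
  interpret groupoid G m by (rule assms(1))
  note d = dom_id_props(1)[OF \<open>g \<in> G\<close>] and r = ran_id_props(1)[OF \<open>g \<in> G\<close>]
  show ?thesis
    using ran_id_inverse[OF \<open>g \<in> G\<close> is_inverse_inverse_of[OF \<open>g \<in> G\<close>]]
      dom_id_identity[OF d] dom_id_identity[OF r] ran_id_identity[OF d] ran_id_identity[OF r]
    by simp
qed

end
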